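(* For a Tychonoff space $X$, the following conditions are equivalent: (1) $C_{\downarrow F}(X,\mathbb R)$ is Baire; (2) $C_{\downarrow F}(X,\mathbb R)$ is Choquet; (3) $C_{\downarrow F}(X,\mathbb R)$ is strong Choquet; (4) $X$ is discrete.
   Context: Fell hypograph topology: $C(X,\mathbb R)$ is the set of continuous functions $X\to\mathbb R$. $C_{\downarrow F}(X,\mathbb R)$ is $C(X,\mathbb R)$ endowed with the Fell hypograph topology: identify $f$ with its hypograph ${\downarrow}f=\{(x,y)\in X\times\mathbb R:y\le f(x)\}$ and take the topology inherited from the set of closed subsets of $X\times\mathbb R$ with the Fell topology (for a space $Z$ the Fell topology on closed subsets of $Z$ is generated by the subbase of sets $\{F:F\cap U\ne\emptyset\}$, $U\subset Z$ open, and $\{F:F\subset Z\setminus K\}$, $K\subset Z$ compact). For Hausdorff $X$ it is generated by the subbase of sets $\{f:\sup f(U)>y\}$ and $\{f:\max f(K)<y\}$, where $U\subset X$ is non-empty open, $K\subset X$ is non-empty compact and $y\in\mathbb R$. Choquet game on a space $Z$: players $\mathsf E$ and $\mathsf N$ alternately choose non-empty open sets $U_1\supset V_1\supset U_2\supset V_2\supset\cdots$ ($\mathsf E$ starts and chooses the $U_n$, $\mathsf N$ chooses the $V_n$); $\mathsf E$ wins if $\bigcap_nU_n=\emptyset$, otherwise $\mathsf N$ wins. Strong Choquet game: same, except that at the $n$-th inning $\mathsf E$ chooses an open $U_n\subset V_{n-1}$ (with $U_1$ any open set) together with a point $x_n\in U_n$, and $\mathsf N$ must choose an open $V_n$ with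 $x_n\in V_n\subset U_n$. $Z$ is Choquet (strong Choquet) if $\mathsf N$ has a winning strategy in the Choquet (strong Choquet) game on $Z$. A space is Baire if every countable intersection of open dense subsets is dense. *)

theory Defs
  imports "HOL-Analysis.Analysis"
begin

definition tychonoff_space :: "'a topology \<Rightarrow> bool" where
  "tychonoff_space X \<longleftrightarrow> completely_regular_space X \<and> Hausdorff_space X"

definition fell_topology :: "'a topology \<Rightarrow> 'a set topology" where
  "fell_topology Z = topology_generated_by
     ({{F. closedin Z F \<and> F \<inter> U \<noteq> {}} | U. openin Z U} \<union>
      {{F. closedin Z F \<and> F \<subseteq> topspace Z - K} | K. compactin Z K})"

text \<open>The functions are taken extensional, so that two functions agreeing on
  the carrier of the space are the same point.\<close>

definition continuous_functions :: "'a topology \<Rightarrow> ('a \<Rightarrow> real) set" where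
  "continuous_functions X = {f \<in> extensional (topspace X). continuous_map X euclideanreal f}"

definition hypograph :: "'a topology \<Rightarrow> ('a \<Rightarrow> real) \<Rightarrow> ('a \<times> real) set" where
  "hypograph X f = {(x, y). x \<in> topspace X \<and> y \<le> f x}"

definition fell_hypograph_topology :: "'a topology \<Rightarrow> ('a \<Rightarrow> real) topology" where
  "fell_hypograph_topology X =
     pullback_topology (continuous_functions X) (hypograph X)
       (fell_topology (prod_topology X euclideanreal))"

definition baire_space :: "'a topology \<Rightarrow> bool" where
  "baire_space Z \<longleftrightarrow>
     (\<forall>\<G>. countable \<G> \<and> (\<forall>G\<in>\<G>. openin Z G \<and> Z closure_of G = topspace Z)
        \<longrightarrow> Z closure_of (\<Inter>\<G>) = topspace Z)"

text \<open>In both games innings are numbered from 0. A strategy for \<open>N\<close> maps the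
  list of the moves made by \<open>E\<close> so far (the current one last) to the next move of \<open>N\<close>;
  the earlier moves of \<open>N\<close> are determined by the strategy. A strategy is winning if,
  as long as \<open>E\<close> has obeyed the rules, it prescribes legal moves, and every infinite
  run in which \<open>E\<close> obeys the rules is won by \<open>N\<close>.\<close>

definition choquet_legal ::
  "'a topology \<Rightarrow> ('a set list \<Rightarrow> 'a set) \<Rightarrow> (nat \<Rightarrow> 'a set) \<Rightarrow> nat \<Rightarrow> bool" where
  "choquet_legal Z \<sigma> U n \<longleftrightarrow>
     openin Z (U n) \<and> U n \<noteq> {} \<and> (n > 0 \<longrightarrow> U n \<subseteq> \<sigma> (map U [0..<n]))"

definition choquet_winning :: "'a topology \<Rightarrow> ('a set list \<Rightarrow> 'a set) \<Rightarrow> bool" where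
  "choquet_winning Z \<sigma> \<longleftrightarrow>
     (\<forall>U.
        (\<forall>n. (\<forall>k\<le>n. choquet_legal Z \<sigma> U k) \<longrightarrow>
             (let V = \<sigma> (map U [0..<Suc n]) in openin Z V \<and> V \<noteq> {} \<and> V \<subseteq> U n)) \<and>
        ((\<forall>n. choquet_legal Z \<sigma> U n) \<longrightarrow> (\<Inter>n. U n) \<noteq> {}))"

definition choquet_space :: "'a topology \<Rightarrow> bool" where
  "choquet_space Z \<longleftrightarrow> (\<exists>\<sigma>. choquet_winning Z \<sigma>)"

definition strong_choquet_legal ::
  "'a topology \<Rightarrow> (('a set \<times> 'a) list \<Rightarrow> 'a set) \<Rightarrow> (nat \<Rightarrow> 'a set \<times> 'a) \<Rightarrow> nat \<Rightarrow> bool" where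
  "strong_choquet_legal Z \<sigma> m n \<longleftrightarrow>
     openin Z (fst (m n)) \<and> snd (m n) \<in> fst (m n) \<and>
     (n > 0 \<longrightarrow> fst (m n) \<subseteq> \<sigma> (map m [0..<n]))"

definition strong_choquet_winning ::
  "'a topology \<Rightarrow> (('a set \<times> 'a) list \<Rightarrow> 'a set) \<Rightarrow> bool" where
  "strong_choquet_winning Z \<sigma> \<longleftrightarrow>
     (\<forall>m.
        (\<forall>n. (\<forall>k\<le>n. strong_choquet_legal Z \<sigma> m k) \<longrightarrow>
             (let V = \<sigma> (map m [0..<Suc n]) in
                openin Z V \<and> snd (m n) \<in> V \<and> V \<subseteq> fst (m n))) \<and>
        ((\<forall>n. strong_choquet_legal Z \<sigma> m n) \<longrightarrow> (\<Inter>n. fst (m n)) \<noteq> {}))"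

definition strong_choquet_space :: "'a topology \<Rightarrow> bool" where
  "strong_choquet_space Z \<longleftrightarrow> (\<exists>\<sigma>. strong_choquet_winning Z \<sigma>)"

lemma topspace_fell_topology: "topspace (fell_topology Z) = {F. closedin Z F}"
proof -
  have "{F. closedin Z F} \<in> {{F. closedin Z F \<and> F \<subseteq> topspace Z - K} | K. compactin Z K}"
    using closedin_subset by (intro CollectI exI[of _ "{}"]) auto
  then show ?thesis
    unfolding fell_topology_def topology_generated_by_topspace Union_Un_distrib
    by (intro equalityI Un_least Union_least le_supI2 Union_upper) auto
qed

lemma closedin_hypograph:
  assumes "continuous_map X euclideanreal f"
  shows "closedin (prod_topology X euclideanreal) (hypograph X f)"
proof -
  let ?P = "prod_topology X euclideanreal"
  have "continuous_map ?P euclideanreal (\<lambda>z. snd z - (f \<circ> fst) z)"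
    using assms by (intro continuous_map_diff continuous_map_compose[OF continuous_map_fst]
        continuous_map_snd)
  then have "closedin ?P {z \<in> topspace ?P. snd z - (f \<circ> fst) z \<in> {..0}}"
    by (intro closedin_continuous_map_preimage) auto
  also have "{z \<in> topspace ?P. snd z - (f \<circ> fst) z \<in> {..0}} = hypograph X f"
    by (auto simp: hypograph_def)
  finally show ?thesis .
qed

lemma inj_on_hypograph: "inj_on (hypograph X) (continuous_functions X)"
proof (rule inj_onI)
  fix f g assume f: "f \<in> continuous_functions X" and g: "g \<in> continuous_functions X"
    and eq: "hypograph X f = hypograph X g"
  show "f = g"
  proof (rule extensionalityI)
    show "f \<in> extensional (topspace X)" "g \<in> extensional (topspace X)"
      using f g by (auto simp: continuous_functions_def)
    fix x assume x: "x \<in> topspace X"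
    have "(x, f x) \<in> hypograph X g" "(x, g x) \<in> hypograph X f"
      using x eq by (auto simp: hypograph_def)
    then show "f x = g x" by (simp add: hypograph_def)
  qed
qed

lemma topspace_fell_hypograph_topology:
  "topspace (fell_hypograph_topology X) = continuous_functions X"
  by (auto simp: fell_hypograph_topology_def topspace_pullback_topology topspace_fell_topology
      continuous_functions_def intro: closedin_hypograph)

end

theory Submission
  imports Defs
begin

text \<open>Lowering a continuous function near a non-isolated point \<open>x\<close> keeps it in a given
  neighbourhood, provided it is left unchanged at finitely many points, which can be chosen
  different from \<open>x\<close>. Hence the open sets \<open>{f. f x < - n}\<close> are all dense, and their intersection
  is empty: the function space is not Baire. If \<open>X\<close> is discrete, the topology is that of
  pointwise convergence, and \<open>N\<close> wins the strong Choquet game by answering \<open>(U, f)\<close> with a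
  basic neighbourhood of \<open>f\<close> of half the radius of one contained in \<open>U\<close>: on each coordinate
  the resulting closed intervals have a common point by compactness.\<close>

subsection \<open>Topological games\<close>

text \<open>A nonempty open set turns into a strong Choquet move once a point of it is attached.
  \<open>\<tau>\<close> attaches such points to the whole history and consults
  \<open>\<sigma>\<close>, whose reply contains the attached point and is therefore
  nonempty.\<close>

lemma strong_choquet_imp_choquet:
  assumes "strong_choquet_space Z"
  shows "choquet_space Z"
proof -
  obtain \<sigma> where \<sigma>: "strong_choquet_winning Z \<sigma>"
    using assms by (auto simp: strong_choquet_space_def)
  define p where "p U = (U, SOME x. x \<in> U)" for U :: "'a set"
  define \<tau> where "\<tau> l = \<sigma> (map p l)" for l
  have legal: "strong_choquet_legal Z \<sigma> (p \<circ> U) n" if "choquet_legal Z \<tau> U n" for U n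
    using that by (auto simp: choquet_legal_def strong_choquet_legal_def p_def \<tau>_def some_in_eq comp_def)
  have "choquet_winning Z \<tau>"
    unfolding choquet_winning_def
  proof (intro allI conjI impI)
    fix U n assume "\<forall>k\<le>n. choquet_legal Z \<tau> U k"
    then have "\<forall>k\<le>n. strong_choquet_legal Z \<sigma> (p \<circ> U) k"
      using legal by blast
    with \<sigma> have "let V = \<sigma> (map (p \<circ> U) [0..<Suc n]) in
        openin Z V \<and> snd ((p \<circ> U) n) \<in> V \<and> V \<subseteq> fst ((p \<circ> U) n)"
      unfolding strong_choquet_winning_def by blast
    moreover have "\<sigma> (map (p \<circ> U) [0..<Suc n]) = \<tau> (map U [0..<Suc n])"
      by (simp add: \<tau>_def)
    ultimately show "let V = \<tau> (map U [0..<Suc n]) in openin Z V \<and> V \<noteq> {} \<and> V \<subseteq> U n"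
      unfolding Let_def by (auto simp: p_def)
  next
    fix U assume "\<forall>n. choquet_legal Z \<tau> U n"
    then have "\<forall>n. strong_choquet_legal Z \<sigma> (p \<circ> U) n"
      using legal by blast
    with \<sigma> have "(\<Inter>n. fst ((p \<circ> U) n)) \<noteq> {}"
      unfolding strong_choquet_winning_def by blast
    then show "(\<Inter>n. U n) \<noteq> {}"
      by (simp add: p_def)
  qed
  then show ?thesis
    by (auto simp: choquet_space_def)
qed

text \<open>Let E cut each reply of N down by the next dense open set. Density keeps these moves
  nonempty, and the point that N's winning strategy guarantees lies in all the dense sets and in the
  prescribed open set \<open>T\<close>.\<close>

lemma choquet_imp_baire:
  assumes "choquet_space Z"
  shows "baire_space Z"
  unfolding baire_space_def
proof (intro allI impI)
  fix \<G> assume \<G>: "countable \<G> \<and> (\<forall>G\<in>\<G>. openin Z G \<and> Z closure_of G = topspace Z)"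
  obtain \<sigma> where \<sigma>: "choquet_winning Z \<sigma>"
    using assms by (auto simp: choquet_space_def)
  \<comment> \<open>The empty family has no enumeration and is treated apart: its intersection is
    \<open>UNIV\<close>, of which \<open>closure_of\<close> sees only the part inside the
    carrier.\<close>
  show "Z closure_of (\<Inter>\<G>) = topspace Z"
  proof (cases "\<G> = {}")
    case True
    then show ?thesis
      by (metis Inf_empty closure_of_restrict closure_of_topspace inf_top_right)
  next
    case False
    define g where "g = from_nat_into \<G>"
    have g: "range g = \<G>"
      using False \<G> by (simp add: g_def range_from_nat_into)
    then have g_open: "openin Z (g n)" and g_dense: "Z closure_of (g n) = topspace Z" for n
      using \<G> by auto
    have meets: "W \<inter> g n \<noteq> {}" if "openin Z W" "W \<noteq> {}" for W n
      using g_dense[of n] that unfolding dense_intersects_open by blast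
    show ?thesis
      unfolding dense_intersects_open
    proof (intro allI impI)
      fix T assume T: "openin Z T \<and> T \<noteq> {}"
      \<comment> \<open>The strategy reads the whole history, so the recursion produces lists:
        \<open>H n\<close> holds the moves of E in innings 0 to \<open>n\<close>, and
        \<open>U n\<close> is the newest of them.\<close>
      define H where "H = rec_nat [T \<inter> g 0] (\<lambda>n l. l @ [\<sigma> l \<inter> g (Suc n)])"
      define U where "U n = last (H n)" for n
      have H_Suc: "H (Suc n) = H n @ [\<sigma> (H n) \<inter> g (Suc n)]" for n
        by (simp add: H_def)
      have H: "H n = map U [0..<Suc n]" for n
      proof (induction n)
        case 0
        then show ?case by (simp add: U_def H_def)
      next
        case (Suc n)
        have "U (Suc n) = \<sigma> (H n) \<inter> g (Suc n)"
          unfolding U_def H_Suc by simp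
        with Suc show ?case
          unfolding H_Suc by simp
      qed
      have U_0: "U 0 = T \<inter> g 0"
        by (simp add: U_def H_def)
      have U_Suc: "U (Suc n) = \<sigma> (map U [0..<Suc n]) \<inter> g (Suc n)" for n
        unfolding H[symmetric] by (simp add: U_def H_Suc)
      \<comment> \<open>Strong induction, because \<open>\<sigma>\<close> promises a good reply only
        when all moves so far were legal.\<close>
      have "choquet_legal Z \<sigma> U n" for n
      proof (induction n rule: less_induct)
        case (less n)
        show ?case
        proof (cases n)
          case 0
          then show ?thesis
            using T g_open meets by (auto simp: choquet_legal_def U_0)
        next
          case (Suc m)
          then have "\<forall>k\<le>m. choquet_legal Z \<sigma> U k"
            using less by simp
          with \<sigma> have "let V = \<sigma> (map U [0..<Suc m]) in openin Z V \<and> V \<noteq> {} \<and> V \<subseteq> U m"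
            unfolding choquet_winning_def by blast
          then show ?thesis
            unfolding choquet_legal_def Suc U_Suc Let_def
            using g_open meets by blast
        qed
      qed
      then have "(\<Inter>n. U n) \<noteq> {}"
        using \<sigma> unfolding choquet_winning_def by blast
      then obtain z where z: "\<And>n. z \<in> U n"
        by blast
      have "z \<in> g n" for n
        using z[of n] by (cases n) (auto simp: U_0 U_Suc simp del: upt_Suc)
      moreover have "z \<in> T"
        using z[of 0] by (simp add: U_0)
      ultimately show "\<Inter>\<G> \<inter> T \<noteq> {}"
        unfolding g[symmetric] by blast
    qed
  qed
qed

subsection \<open>Neighbourhoods in the Fell hypograph topology\<close>

lemma openin_hypograph_miss:
  assumes "compactin (prod_topology X euclideanreal) K"
  shows "openin (fell_hypograph_topology X)
           {f \<in> continuous_functions X. hypograph X f \<inter> K = {}}"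
proof -
  let ?Z = "prod_topology X euclideanreal"
  have "openin (fell_topology ?Z) {F. closedin ?Z F \<and> F \<subseteq> topspace ?Z - K}"
    unfolding fell_topology_def using assms by (intro topology_generated_by_Basis) blast
  moreover have "{f \<in> continuous_functions X. hypograph X f \<inter> K = {}} =
      hypograph X -` {F. closedin ?Z F \<and> F \<subseteq> topspace ?Z - K} \<inter> continuous_functions X"
    by (auto simp: continuous_functions_def closedin_hypograph) (auto simp: hypograph_def)
  ultimately show ?thesis
    unfolding fell_hypograph_topology_def openin_pullback_topology by blast
qed

lemma openin_hypograph_hit:
  assumes "openin (prod_topology X euclideanreal) U"
  shows "openin (fell_hypograph_topology X)
           {f \<in> continuous_functions X. hypograph X f \<inter> U \<noteq> {}}"
proof -
  let ?Z = "prod_topology X euclideanreal"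
  have "openin (fell_topology ?Z) {F. closedin ?Z F \<and> F \<inter> U \<noteq> {}}"
    unfolding fell_topology_def using assms by (intro topology_generated_by_Basis) blast
  moreover have "{f \<in> continuous_functions X. hypograph X f \<inter> U \<noteq> {}} =
      hypograph X -` {F. closedin ?Z F \<and> F \<inter> U \<noteq> {}} \<inter> continuous_functions X"
    by (auto simp: continuous_functions_def closedin_hypograph)
  ultimately show ?thesis
    unfolding fell_hypograph_topology_def openin_pullback_topology by blast
qed

text \<open>The singleton \<open>{(x, y)}\<close> is compact, and a hypograph misses it exactly when
  the function is below \<open>y\<close> at \<open>x\<close>.\<close>

lemma openin_fell_hypograph_less:
  assumes "x \<in> topspace X"
  shows "openin (fell_hypograph_topology X) {f \<in> continuous_functions X. f x < y}"
proof -
  have "compactin (prod_topology X euclideanreal) {(x, y)}"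
    using assms by simp
  moreover have "hypograph X f \<inter> {(x, y)} = {} \<longleftrightarrow> f x < y" for f
    using assms by (auto simp: hypograph_def)
  ultimately show ?thesis
    using openin_hypograph_miss[of X "{(x, y)}"] by simp
qed

text \<open>Isolation of \<open>x\<close> makes the vertical ray \<open>{x} \<times> {y<..}\<close>
  open, so that hitting it is a subbasic condition.\<close>

lemma openin_fell_hypograph_greater:
  assumes "openin X {x}"
  shows "openin (fell_hypograph_topology X) {f \<in> continuous_functions X. y < f x}"
proof -
  have "x \<in> topspace X"
    using openin_subset[OF assms] by simp
  then have "hypograph X f \<inter> {x} \<times> {y<..} \<noteq> {} \<longleftrightarrow> y < f x" for f
    by (auto simp: hypograph_def)
  moreover have "openin (prod_topology X euclideanreal) ({x} \<times> {y<..})"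
    using assms by (simp add: openin_prod_Times_iff)
  ultimately show ?thesis
    using openin_hypograph_hit[of X "{x} \<times> {y<..}"] by simp
qed

text \<open>A property of neighbourhoods of \<open>f\<close> that is inherited by finite
  intersections and supersets need only be checked on the subbasic sets containing \<open>f\<close>.
  Both descriptions of neighbourhoods below rest on this.\<close>

lemma fell_hypograph_nbhd_induct [consumes 2, case_names top hit miss inter mono]:
  assumes V: "openin (fell_hypograph_topology X) V" "f \<in> V"
  assumes top: "P (continuous_functions X)"
    and hit: "\<And>U x y. \<lbrakk>openin (prod_topology X euclideanreal) U; (x, y) \<in> U; x \<in> topspace X; y \<le> f x\<rbrakk>
        \<Longrightarrow> P {g \<in> continuous_functions X. hypograph X g \<inter> U \<noteq> {}}"
    and miss: "\<And>K. \<lbrakk>compactin (prod_topology X euclideanreal) K; hypograph X f \<inter> K = {}\<rbrakk>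
        \<Longrightarrow> P {g \<in> continuous_functions X. hypograph X g \<inter> K = {}}"
    and inter: "\<And>V W. P V \<Longrightarrow> P W \<Longrightarrow> P (V \<inter> W)"
    and mono: "\<And>V W. P V \<Longrightarrow> V \<subseteq> W \<Longrightarrow> P W"
  shows "P V"
proof -
  let ?Z = "prod_topology X euclideanreal"
  let ?C = "continuous_functions X"
  obtain T where T: "openin (fell_topology ?Z) T" "V = hypograph X -` T \<inter> ?C"
    using V unfolding fell_hypograph_topology_def openin_pullback_topology by blast
  have "hypograph X f \<in> T"
    using T V by auto
  moreover have "generate_topology_on
     ({{F. closedin ?Z F \<and> F \<inter> U \<noteq> {}} | U. openin ?Z U} \<union>
      {{F. closedin ?Z F \<and> F \<subseteq> topspace ?Z - K} | K. compactin ?Z K}) T"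
    using T by (simp add: fell_topology_def openin_topology_generated_by_iff)
  \<comment> \<open>Keeping membership of \<open>hypograph X f\<close> as a premise makes the empty
    set vacuous and reduces a union to one member that contains this point.\<close>
  then have "hypograph X f \<in> T \<longrightarrow> P (hypograph X -` T \<inter> ?C)"
  proof induction
    case Empty
    then show ?case by simp
  next
    case (Int a b)
    then show ?case
      using inter[of "hypograph X -` a \<inter> ?C" "hypograph X -` b \<inter> ?C"]
      by (auto intro: mono)
  next
    case (UN \<K>)
    show ?case
    proof
      assume "hypograph X f \<in> \<Union>\<K>"
      then obtain k where "k \<in> \<K>" "P (hypograph X -` k \<inter> ?C)"
        using UN by blast
      then show "P (hypograph X -` \<Union>\<K> \<inter> ?C)"
        by (auto intro: mono)
    qed
  next
    case (Basis s)
    then show ?case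
    proof (elim UnE CollectE exE conjE)
      fix U assume s: "s = {F. closedin ?Z F \<and> F \<inter> U \<noteq> {}}" and U: "openin ?Z U"
      have "hypograph X -` s \<inter> ?C = {g \<in> ?C. hypograph X g \<inter> U \<noteq> {}}"
        by (auto simp: s continuous_functions_def closedin_hypograph)
      moreover have "\<exists>x y. (x, y) \<in> U \<and> x \<in> topspace X \<and> y \<le> f x" if "hypograph X f \<in> s"
        using that by (auto simp: s hypograph_def)
      ultimately show ?case
        using hit[OF U] by auto
    next
      fix K assume s: "s = {F. closedin ?Z F \<and> F \<subseteq> topspace ?Z - K}" and K: "compactin ?Z K"
      have "hypograph X -` s \<inter> ?C = {g \<in> ?C. hypograph X g \<inter> K = {}}"
        by (auto simp: s continuous_functions_def closedin_hypograph) (auto simp: hypograph_def)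
      moreover have "hypograph X f \<inter> K = {}" if "hypograph X f \<in> s"
        using that by (auto simp: s)
      ultimately show ?case
        using miss[OF K] by auto
    qed
  qed
  ultimately show ?thesis
    using T by simp
qed

lemma openin_prod_euclideanreal_box:
  fixes y :: real
  assumes "openin (prod_topology X euclideanreal) U" "(x, y) \<in> U"
  obtains W e where "openin X W" "x \<in> W" "e > 0" "W \<times> ball y e \<subseteq> U"
proof -
  have "\<exists>W S. openin X W \<and> open S \<and> x \<in> W \<and> y \<in> S \<and> W \<times> S \<subseteq> U"
    using assms(1)[unfolded openin_prod_topology_alt, rule_format, OF assms(2)] by simp
  then obtain W S where WS: "openin X W" "open S" "x \<in> W" "y \<in> S" "W \<times> S \<subseteq> U"
    by (elim exE conjE)
  obtain e where e: "e > 0" "ball y e \<subseteq> S"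
    using WS by (meson openE)
  show thesis
    by (rule that[OF WS(1,3) e(1)]) (use WS(5) e(2) in blast)
qed

subsection \<open>Baire function spaces\<close>

text \<open>Lowering \<open>f\<close> shrinks its hypograph, so conditions of missing a compact set
  survive. Each condition of hitting an open set is secured by a single point at which
  \<open>f\<close> is unchanged; since \<open>x\<close> is not isolated, that point can be moved off
  \<open>x\<close>.\<close>

lemma fell_hypograph_lowering:
  assumes V: "openin (fell_hypograph_topology X) V" "f \<in> V"
    and x: "x \<in> topspace X" "\<not> openin X {x}"
  obtains A where "finite A" "A \<subseteq> topspace X - {x}"
    "\<And>g. \<lbrakk>g \<in> continuous_functions X; \<And>z. z \<in> topspace X \<Longrightarrow> g z \<le> f z;
          \<And>z. z \<in> A \<Longrightarrow> g z = f z\<rbrakk> \<Longrightarrow> g \<in> V"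
proof -
  have f: "continuous_map X euclideanreal f"
    using openin_subset[OF V(1)] V(2)
    by (auto simp: topspace_fell_hypograph_topology continuous_functions_def)
  have "\<exists>A. finite A \<and> A \<subseteq> topspace X - {x} \<and>
     (\<forall>g\<in>continuous_functions X. (\<forall>z\<in>topspace X. g z \<le> f z) \<and> (\<forall>z\<in>A. g z = f z) \<longrightarrow> g \<in> V)"
    using V
  proof (induction rule: fell_hypograph_nbhd_induct)
    case top
    then show ?case by blast
  next
    case (hit U a y)
    obtain W e where W: "openin X W" "a \<in> W" "e > 0" "W \<times> ball y e \<subseteq> U"
      using openin_prod_euclideanreal_box hit by metis
    \<comment> \<open>Over \<open>?W\<close> the hypograph of \<open>f\<close> contains the height
      \<open>y - e/2\<close>, which is still within \<open>e\<close> of \<open>y\<close>. As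
      \<open>?W\<close> is open, it contains a point other than \<open>x\<close>.\<close>
    let ?W = "W \<inter> {z \<in> topspace X. f z \<in> {y - e/2 <..}}"
    have W': "openin X ?W" "a \<in> ?W"
      using W hit openin_continuous_map_preimage[OF f, of "{y - e/2 <..}"] by auto
    obtain z where z: "z \<in> ?W" "z \<noteq> x"
    proof (cases "a = x")
      case True
      then have "?W \<noteq> {x}"
        using W' x by metis
      then show thesis
        using that W' True by blast
    qed (use that W' in blast)
    have "(z, y - e/2) \<in> U"
      using W z by (auto simp: dist_real_def subset_iff)
    moreover have "(z, y - e/2) \<in> hypograph X g" if "g z = f z" for g
      using that z by (auto simp: hypograph_def)
    ultimately show ?case
      using z by (intro exI[of _ "{z}"]) auto
  next
    case (miss K)
    have "hypograph X g \<subseteq> hypograph X f" if "\<forall>z\<in>topspace X. g z \<le> f z" for g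
      using that by (force simp: hypograph_def)
    with miss show ?case
      by (intro exI[of _ "{}"]) blast
  next
    case (inter V W)
    then obtain A B where "finite A" "A \<subseteq> topspace X - {x}" "finite B" "B \<subseteq> topspace X - {x}"
      "\<forall>g\<in>continuous_functions X. (\<forall>z\<in>topspace X. g z \<le> f z) \<and> (\<forall>z\<in>A. g z = f z) \<longrightarrow> g \<in> V"
      "\<forall>g\<in>continuous_functions X. (\<forall>z\<in>topspace X. g z \<le> f z) \<and> (\<forall>z\<in>B. g z = f z) \<longrightarrow> g \<in> W"
      by auto
    then show ?case
      by (intro exI[of _ "A \<union> B"]) auto
  next
    case (mono V W)
    then show ?case by (meson subsetD)
  qed
  then obtain A where "finite A" "A \<subseteq> topspace X - {x}"
    "\<forall>g\<in>continuous_functions X. (\<forall>z\<in>topspace X. g z \<le> f z) \<and> (\<forall>z\<in>A. g z = f z) \<longrightarrow> g \<in> V"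
    by (elim exE conjE)
  then show thesis
    by (intro that[of A]) auto
qed

lemma fell_hypograph_less_dense:
  assumes X: "tychonoff_space X" and x: "x \<in> topspace X" "\<not> openin X {x}"
  shows "fell_hypograph_topology X closure_of {f \<in> continuous_functions X. f x < y} =
         topspace (fell_hypograph_topology X)"
  unfolding dense_intersects_open
proof (intro allI impI)
  fix V assume V: "openin (fell_hypograph_topology X) V \<and> V \<noteq> {}"
  then obtain f where fV: "f \<in> V"
    by blast
  have f: "continuous_map X euclideanreal f"
    using openin_subset V fV
    by (force simp: topspace_fell_hypograph_topology continuous_functions_def)
  obtain A where A: "finite A" "A \<subseteq> topspace X - {x}"
    and AV: "\<And>g. \<lbrakk>g \<in> continuous_functions X; \<And>z. z \<in> topspace X \<Longrightarrow> g z \<le> f z;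
          \<And>z. z \<in> A \<Longrightarrow> g z = f z\<rbrakk> \<Longrightarrow> g \<in> V"
    using fell_hypograph_lowering V fV x by metis
  have "closedin X A"
    using A X by (intro closedin_Hausdorff_finite) (auto simp: tychonoff_space_def)
  then obtain b where b: "continuous_map X (top_of_set {0..1::real}) b" "b x = 0" "b ` A \<subseteq> {1}"
    using X x A unfolding tychonoff_space_def completely_regular_space_def
    by (metis DiffI DiffD2 insertI1 subsetD)
  then have b_cont: "continuous_map X euclideanreal b" and b_le: "z \<in> topspace X \<Longrightarrow> b z \<le> 1" for z
    by (auto simp: continuous_map_in_subtopology Pi_iff)
  \<comment> \<open>Since \<open>b x = 0\<close>, the value at \<open>x\<close> drops by the full
    \<open>c\<close>, which is large enough to get below \<open>y\<close>; \<open>c \<ge> 0\<close>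
    together with \<open>b \<le> 1\<close> gives \<open>g \<le> f\<close>, and \<open>b = 1\<close>
    on \<open>A\<close> gives equality there.\<close>
  define c where "c = \<bar>f x\<bar> + \<bar>y\<bar> + 1"
  define g where "g = restrict (\<lambda>z. f z - c * (1 - b z)) (topspace X)"
  have "continuous_map X euclideanreal (\<lambda>z. f z - c * (1 - b z))"
    using f b_cont by (intro continuous_intros) auto
  then have g: "g \<in> continuous_functions X"
    unfolding g_def continuous_functions_def
    by (auto intro: continuous_map_eq)
  have "g \<in> V"
  proof (rule AV[OF g])
    show "g z \<le> f z" if "z \<in> topspace X" for z
      using that b_le[OF that] by (simp add: g_def c_def)
    show "g z = f z" if "z \<in> A" for z
      using that A b by (auto simp: g_def)
  qed
  moreover have "g x < y"
    using x b by (simp add: g_def c_def)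
  ultimately show "{f \<in> continuous_functions X. f x < y} \<inter> V \<noteq> {}"
    using g by blast
qed

lemma baire_fell_hypograph_imp_discrete:
  assumes X: "tychonoff_space X" and baire: "baire_space (fell_hypograph_topology X)"
  shows "X = discrete_topology (topspace X)"
proof -
  have "openin X {x}" if x: "x \<in> topspace X" for x
  proof (rule ccontr)
    assume nx: "\<not> openin X {x}"
    let ?G = "\<lambda>n::nat. {f \<in> continuous_functions X. f x < - real n}"
    have "fell_hypograph_topology X closure_of (\<Inter>(range ?G)) = topspace (fell_hypograph_topology X)"
    proof (rule baire[unfolded baire_space_def, rule_format], intro conjI ballI)
      fix G assume "G \<in> range ?G"
      then show "openin (fell_hypograph_topology X) G"
        and "fell_hypograph_topology X closure_of G = topspace (fell_hypograph_topology X)"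
        using openin_fell_hypograph_less[OF x] fell_hypograph_less_dense[OF X x nx] by auto
    qed simp
    moreover have "\<Inter>(range ?G) = {}"
    proof -
      have False if "\<And>n. f \<in> ?G n" for f
      proof -
        obtain n where "- f x < real n"
          using reals_Archimedean2 by blast
        then show False
          using that[of n] by auto
      qed
      then show ?thesis by blast
    qed
    \<comment> \<open>The zero function shows that the space is nonempty, so the empty intersection
      cannot be dense.\<close>
    moreover have "restrict (\<lambda>z. 0) (topspace X) \<in> continuous_functions X"
      unfolding continuous_functions_def by (auto intro: continuous_map_eq[of _ _ "\<lambda>z. 0"])
    ultimately show False
      by (auto simp: topspace_fell_hypograph_topology)
  qed
  then show ?thesis
    by (metis discrete_topology_unique)
qed

subsection \<open>Discrete spaces\<close>

text \<open>For finite \<open>A\<close> and positive \<open>e\<close> these are the basic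
  neighbourhoods of \<open>f\<close> in the topology of pointwise convergence.\<close>

definition fun_ball :: "'a topology \<Rightarrow> ('a \<Rightarrow> real) \<Rightarrow> 'a set \<Rightarrow> real \<Rightarrow> ('a \<Rightarrow> real) set" where
  "fun_ball X f A e = {g \<in> continuous_functions X. \<forall>x\<in>A. \<bar>g x - f x\<bar> < e}"

lemma openin_fun_ball:
  assumes "finite A" "\<And>x. x \<in> A \<Longrightarrow> openin X {x}"
  shows "openin (fell_hypograph_topology X) (fun_ball X f A e)"
  using assms
proof (induction A)
  case empty
  then show ?case
    using openin_topspace[of "fell_hypograph_topology X"]
    by (simp add: fun_ball_def topspace_fell_hypograph_topology)
next
  case (insert a A)
  have a: "a \<in> topspace X"
    using openin_subset[of X "{a}"] insert by simp
  have "fun_ball X f (insert a A) e = fun_ball X f A e \<inter>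
      ({g \<in> continuous_functions X. g a < f a + e} \<inter> {g \<in> continuous_functions X. f a - e < g a})"
    by (auto simp: fun_ball_def abs_less_iff)
  then show ?case
    using insert a
    by (simp add: openin_fell_hypograph_less openin_fell_hypograph_greater openin_Int)
qed

text \<open>Hitting an open set is decided at one coordinate. A compact set lies over finitely many
  points, as its projection to the discrete space is compact; over each of them it stays a positive
  distance above \<open>f\<close>, and the least of these distances serves as radius.\<close>

lemma discrete_fell_hypograph_fun_ball:
  assumes X: "X = discrete_topology (topspace X)"
    and V: "openin (fell_hypograph_topology X) V" "f \<in> V"
  shows "\<exists>A e. finite A \<and> A \<subseteq> topspace X \<and> e > 0 \<and> fun_ball X f A e \<subseteq> V"
  using V
proof (induction rule: fell_hypograph_nbhd_induct)
  case top
  then show ?case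
    by (intro exI[of _ "{}"] exI[of _ 1]) (auto simp: fun_ball_def)
next
  case (hit U x y)
  obtain W e where W: "openin X W" "x \<in> W" "e > 0" "W \<times> ball y e \<subseteq> U"
    using openin_prod_euclideanreal_box hit by metis
  \<comment> \<open>Descending by \<open>e/2\<close> inside \<open>U\<close> leaves room for
    \<open>g x\<close> to fall below \<open>f x\<close> by less than \<open>e/2\<close>.\<close>
  then have "(x, y - e/2) \<in> U"
    by (auto simp: dist_real_def subset_iff)
  moreover have "(x, y - e/2) \<in> hypograph X g" if "g \<in> fun_ball X f {x} (e/2)" for g
    using that hit abs_ge_minus_self[of "g x - f x"] by (auto simp: fun_ball_def hypograph_def)
  ultimately have "fun_ball X f {x} (e/2) \<subseteq> {g \<in> continuous_functions X. hypograph X g \<inter> U \<noteq> {}}"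
    by (auto simp: fun_ball_def)
  then show ?case
    using W hit by (intro exI[of _ "{x}"] exI[of _ "e/2"]) auto
next
  case (miss K)
  let ?Z = "prod_topology X euclideanreal"
  have KX: "K \<subseteq> topspace X \<times> UNIV"
    using compactin_subset_topspace[OF miss(1)] by auto
  have "compactin X (fst ` K)"
    using miss(1) continuous_map_fst by (rule image_compactin)
  then have fin: "finite (fst ` K)"
    by (metis X compactin_discrete_topology)
  have "compactin euclideanreal (snd ` (K \<inter> {x} \<times> UNIV))" if "x \<in> topspace X" for x
  proof (rule image_compactin[OF _ continuous_map_snd])
    have "closedin X {x}"
      by (metis X closedin_discrete_topology empty_subsetI insert_subset that)
    then have "closedin ?Z ({x} \<times> UNIV)"
      by (simp add: closedin_prod_Times_iff)
    then show "compactin ?Z (K \<inter> {x} \<times> UNIV)"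
      using miss(1) by (simp add: compact_Int_closedin)
  qed
  then have slice: "compact (snd ` (K \<inter> {x} \<times> UNIV))" if "x \<in> topspace X" for x
    using that by simp
  \<comment> \<open>The slice over \<open>x\<close> is compact, so it has a lowest height
    \<open>s\<close>; as the hypograph misses \<open>K\<close>, the gap \<open>s - f x\<close> is
    positive.\<close>
  have "\<exists>d>0. \<forall>y. (x, y) \<in> K \<longrightarrow> f x + d \<le> y" if "x \<in> fst ` K" for x
  proof -
    have x: "x \<in> topspace X" and ne: "snd ` (K \<inter> {x} \<times> UNIV) \<noteq> {}"
      using that KX by auto
    obtain s where s: "s \<in> snd ` (K \<inter> {x} \<times> UNIV)" "\<forall>t\<in>snd ` (K \<inter> {x} \<times> UNIV). s \<le> t"
      using compact_attains_inf[OF slice[OF x] ne] by blast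
    then have "(x, s) \<in> K"
      by auto
    then have "(x, s) \<notin> hypograph X f"
      using miss(2) by blast
    then have "f x < s"
      using x by (simp add: hypograph_def)
    moreover have "s \<le> y" if "(x, y) \<in> K" for y
      using s(2) that by force
    ultimately show ?thesis
      by (intro exI[of _ "s - f x"]) auto
  qed
  then obtain d where d: "\<And>x. x \<in> fst ` K \<Longrightarrow> d x > 0" "\<And>x y. (x, y) \<in> K \<Longrightarrow> f x + d x \<le> y"
    by (metis fst_conv image_eqI)
  \<comment> \<open>The inserted 1 keeps the minimum meaningful when \<open>K\<close> is
    empty.\<close>
  define e where "e = Min (insert 1 (d ` fst ` K))"
  have e: "e > 0" "\<And>x. x \<in> fst ` K \<Longrightarrow> e \<le> d x"
    using fin d(1) by (auto simp: e_def)
  have "fun_ball X f (fst ` K) e \<subseteq> {g \<in> continuous_functions X. hypograph X g \<inter> K = {}}"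
  proof clarify
    fix g assume g: "g \<in> fun_ball X f (fst ` K) e"
    have False if "(x, y) \<in> hypograph X g" "(x, y) \<in> K" for x y
    proof -
      have x: "x \<in> fst ` K"
        using that by force
      have "y \<le> g x" "g x < f x + e"
        using that(1) g x by (auto simp: fun_ball_def hypograph_def abs_less_iff)
      with e(2)[OF x] d(2)[OF that(2)] show False
        by linarith
    qed
    then show "g \<in> continuous_functions X \<and> hypograph X g \<inter> K = {}"
      using g by (auto simp: fun_ball_def)
  qed
  then show ?case
    using fin e KX by (intro exI[of _ "fst ` K"] exI[of _ e]) auto
next
  case (inter V W)
  then obtain A d B e where "finite A" "A \<subseteq> topspace X" "d > 0" "fun_ball X f A d \<subseteq> V"
    "finite B" "B \<subseteq> topspace X" "e > 0" "fun_ball X f B e \<subseteq> W"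
    by auto
  then show ?case
    by (intro exI[of _ "A \<union> B"] exI[of _ "min d e"]) (auto simp: fun_ball_def)
next
  case (mono V W)
  then show ?case by (meson order_trans)
qed

text \<open>For each \<open>n\<close> in \<open>I\<close>, all later centres lie in the closed
  interval of radius \<open>e n\<close> about \<open>r n\<close>. The sequence is thus bounded from
  an index of \<open>I\<close> on, and any subsequential limit lies in all these closed intervals;
  the sequence itself need not converge. \<open>I\<close> will be the set of innings that constrain
  a given coordinate.\<close>

lemma common_point_cball:
  fixes r :: "nat \<Rightarrow> real"
  assumes "\<And>n m. n \<in> I \<Longrightarrow> n \<le> m \<Longrightarrow> \<bar>r m - r n\<bar> \<le> e n"
  shows "\<exists>c. \<forall>n\<in>I. \<bar>c - r n\<bar> \<le> e n"
proof (cases "I = {}")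
  case False
  then obtain k where k: "k \<in> I"
    by blast
  have "range (\<lambda>n. r (n + k)) \<subseteq> cball (r k) (e k)"
    using assms[OF k] by (auto simp: dist_real_def abs_minus_commute[of "r k"])
  then have "bounded (range (\<lambda>n. r (n + k)))"
    using bounded_cball bounded_subset by blast
  then obtain c s where s: "strict_mono s" and lim: "((\<lambda>n. r (n + k)) \<circ> s) \<longlonglongrightarrow> c"
    using bounded_imp_convergent_subsequence by blast
  have "\<bar>c - r n\<bar> \<le> e n" if n: "n \<in> I" for n
  proof (rule LIMSEQ_le_const2)
    show "(\<lambda>i. \<bar>((\<lambda>n. r (n + k)) \<circ> s) i - r n\<bar>) \<longlonglongrightarrow> \<bar>c - r n\<bar>"
      using lim by (intro tendsto_intros)
    have "n \<le> s i + k" if "n \<le> i" for i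
      using seq_suble[OF s, of i] that by simp
    then show "\<exists>N. \<forall>i\<ge>N. \<bar>((\<lambda>n. r (n + k)) \<circ> s) i - r n\<bar> \<le> e n"
      using assms[OF n] by auto
  qed
  then show ?thesis by blast
qed simp

lemma discrete_imp_strong_choquet:
  assumes X: "X = discrete_topology (topspace X)"
  shows "strong_choquet_space (fell_hypograph_topology X)"
proof -
  let ?Z = "fell_hypograph_topology X"
  have pt: "openin X {x}" if "x \<in> topspace X" for x
    by (metis X that empty_subsetI insert_subset openin_discrete_topology)
  have cont: "continuous_map X euclideanreal f" for f
    by (subst X) simp
  \<comment> \<open>The premise sits inside the existential so that \<open>A\<close> and
    \<open>e\<close> can be chosen as functions of every pair \<open>(U, f)\<close>. The factor 2
    reserves twice the radius that N will play.\<close>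
  have "\<exists>A e. openin ?Z U \<and> f \<in> U \<longrightarrow> finite A \<and> A \<subseteq> topspace X \<and> e > 0 \<and> fun_ball X f A (2 * e) \<subseteq> U"
    for U f
  proof (cases "openin ?Z U \<and> f \<in> U")
    case True
    then obtain A e where "finite A" "A \<subseteq> topspace X" "e > 0" "fun_ball X f A e \<subseteq> U"
      using discrete_fell_hypograph_fun_ball[OF X] by metis
    then show ?thesis
      by (intro exI[of _ A] exI[of _ "e/2"]) auto
  qed blast
  then obtain A e where Ae: "\<And>U f. \<lbrakk>openin ?Z U; f \<in> U\<rbrakk> \<Longrightarrow>
      finite (A U f) \<and> A U f \<subseteq> topspace X \<and> e U f > 0 \<and> fun_ball X f (A U f) (2 * e U f) \<subseteq> U"
    by metis
  define V where "V = (\<lambda>(U, f). fun_ball X f (A U f) (e U f))"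
  \<comment> \<open>N's reply depends only on E's latest move.\<close>
  have "strong_choquet_winning ?Z (\<lambda>l. V (last l))"
    unfolding strong_choquet_winning_def
  proof (intro allI conjI impI)
    fix m n assume "\<forall>k\<le>n. strong_choquet_legal ?Z (\<lambda>l. V (last l)) m k"
    then have "strong_choquet_legal ?Z (\<lambda>l. V (last l)) m n"
      by simp
    then obtain U f where m: "m n = (U, f)" and U: "openin ?Z U" "f \<in> U"
      by (cases "m n") (auto simp: strong_choquet_legal_def)
    then have f: "f \<in> continuous_functions X"
      using openin_subset topspace_fell_hypograph_topology by blast
    have "openin ?Z (V (U, f))"
      using Ae[OF U] pt by (auto simp: V_def intro!: openin_fun_ball)
    moreover have "f \<in> V (U, f)"
      using Ae[OF U] f by (auto simp: V_def fun_ball_def)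
    moreover have "V (U, f) \<subseteq> U"
    proof -
      have "V (U, f) \<subseteq> fun_ball X f (A U f) (2 * e U f)"
        using Ae[OF U] by (fastforce simp: V_def fun_ball_def)
      then show ?thesis
        using Ae[OF U] by blast
    qed
    ultimately show "let W = V (last (map m [0..<Suc n])) in
        openin ?Z W \<and> snd (m n) \<in> W \<and> W \<subseteq> fst (m n)"
      by (simp add: m)
  next
    fix m assume legal: "\<forall>n. strong_choquet_legal ?Z (\<lambda>l. V (last l)) m n"
    define U where "U n = fst (m n)" for n
    define f where "f n = snd (m n)" for n
    define B where "B n = A (U n) (f n)" for n
    define r where "r n = e (U n) (f n)" for n
    have U: "openin ?Z (U n)" "f n \<in> U n" for n
      using legal by (auto simp: strong_choquet_legal_def U_def f_def)
    have U_Suc: "U (Suc n) \<subseteq> fun_ball X (f n) (B n) (r n)" for n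
      using legal[rule_format, of "Suc n"]
      by (simp add: strong_choquet_legal_def U_def f_def B_def r_def V_def case_prod_unfold)
    have Br: "B n \<subseteq> topspace X" "r n > 0" "fun_ball X (f n) (B n) (2 * r n) \<subseteq> U n" for n
      using Ae[OF U] by (auto simp: B_def r_def)
    have "fun_ball X (f n) (B n) (r n) \<subseteq> U n" for n
      using Br[of n] by (fastforce simp: fun_ball_def)
    then have dec: "U k \<subseteq> U n" if "n \<le> k" for n k
      using U_Suc lift_Suc_antimono_le[of U, OF _ that] by blast
    \<comment> \<open>For \<open>k > n\<close> the point \<open>f k\<close> lies in
      \<open>U (Suc n)\<close>, hence in N's ball of inning \<open>n\<close>; for
      \<open>k = n\<close> the difference is 0.\<close>
    have close: "\<bar>f k x - f n x\<bar> \<le> r n" if "x \<in> B n" "n \<le> k" for x n k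
    proof (cases "k = n")
      case True
      then show ?thesis using Br(2)[of n] by simp
    next
      case False
      then have "f k \<in> U (Suc n)"
        using U(2)[of k] dec[of "Suc n" k] that by auto
      then show ?thesis
        using U_Suc[of n] that by (force simp: fun_ball_def)
    qed
    have "\<exists>c. \<forall>n\<in>{n. x \<in> B n}. \<bar>c - f n x\<bar> \<le> r n" for x
      using close by (intro common_point_cball) auto
    then obtain c where c: "\<And>x n. x \<in> B n \<Longrightarrow> \<bar>c x - f n x\<bar> \<le> r n"
      by (metis mem_Collect_eq)
    \<comment> \<open>The values \<open>c x\<close> are chosen independently for each coordinate,
      which is harmless because every function on a discrete space is continuous. Where no inning
      constrains \<open>x\<close>, any value will do.\<close>
    define h where "h = restrict c (topspace X)"
    have h: "h \<in> continuous_functions X"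
      using cont by (simp add: continuous_functions_def h_def)
    have "h \<in> U n" for n
    proof -
      \<comment> \<open>Passing to the limit yields only the weak bound \<open>r n\<close>; the
        reserved radius \<open>2 * r n\<close> makes it strict.\<close>
      have "\<bar>h x - f n x\<bar> < 2 * r n" if "x \<in> B n" for x
        using c[OF that] Br(1,2)[of n] that by (auto simp: h_def subset_iff)
      then have "h \<in> fun_ball X (f n) (B n) (2 * r n)"
        using h by (simp add: fun_ball_def)
      then show ?thesis
        using Br(3) by blast
    qed
    then show "(\<Inter>n. fst (m n)) \<noteq> {}"
      by (auto simp: U_def)
  qed
  then show ?thesis
    by (auto simp: strong_choquet_space_def)
qed

theorem corollary1p3:
  fixes X :: "'a topology"
  assumes "tychonoff_space X"
  shows "(baire_space (fell_hypograph_topology X) \<longleftrightarrow> choquet_space (fell_hypograph_topology X)) \<and>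
         (choquet_space (fell_hypograph_topology X) \<longleftrightarrow> strong_choquet_space (fell_hypograph_topology X)) \<and>
         (strong_choquet_space (fell_hypograph_topology X) \<longleftrightarrow> X = discrete_topology (topspace X))"
  \<comment> \<open>The implications close a cycle: discrete, strong Choquet, Choquet, Baire,
    discrete. The Tychonoff hypothesis enters in the last one.\<close>
  using strong_choquet_imp_choquet choquet_imp_baire discrete_imp_strong_choquet
    baire_fell_hypograph_imp_discrete[OF assms]
  by blast

end
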